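(* Let $Q(x)$, where $Q(0)>0$, be a polynomial whose zeros are all real and positive, and let $r$ be a positive integer. Consider the power series $$\frac{1}{Q(x)-tx^r}=\sum_{n=0}^\infty q_n(t)x^n .$$ Then $q_n(t)$ is a polynomial whose zeros are real and negative for each $n\in\mathbb{N}$. Moreover, the zeros of $q_n(t)$ interlace those of $q_{n+1}(t)$ for each $n\in\mathbb{N}$.
   Context: $\mathbb{N}=\{0,1,2,\dots\}$. The expansion is as a formal power series in $x$ with coefficients in $\mathbb{R}[t]$. Interlacing: let $f,g\in\mathbb{R}[t]$ be real-rooted polynomials with positive leading coefficients and zeros $\cdots\le\alpha_3\le\alpha_2\le\alpha_1$ and $\cdots\le\beta_3\le\beta_2\le\beta_1$, respectively. The zeros of $f$ interlace those of $g$, written $f\prec g$, if $\cdots\le\alpha_3\le\beta_3\le\alpha_2\le\beta_2\le\alpha_1\le\beta_1$; in particular the degrees of $f$ and $g$ differ by at most one. By convention, $0\prec f$ and $f\prec 0$ for any real-rooted polynomial $f$.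
   Formalization: The claim that the zeros of q_n(t) are real and negative is made only for nonconstant Q; for constant Q it fails (Q = 1, r = 1 gives q_n(t) = t^n, with zero 0). The interlacing claim is made for all Q. *)

theory Defs
  imports "HOL-Computational_Algebra.Computational_Algebra"
begin

(* The zero polynomial counts as real-rooted, so that 0 interlaces 0 under the convention
   in the definition of interlaces below. *)
definition real_rooted :: "real poly \<Rightarrow> bool" where
  "real_rooted p \<longleftrightarrow>
     p = 0 \<or> (\<forall>z::complex. poly (map_poly complex_of_real p) z = 0 \<longrightarrow> z \<in> \<real>)"

(* The real zeros, repeated according to multiplicity, largest first. *)
definition zeros_desc :: "real poly \<Rightarrow> real list" where
  "zeros_desc p = rev (sorted_list_of_multiset (proots p))"

(* With as = [alpha_1, alpha_2, ...] and bs = [beta_1, beta_2, ...] in decreasing order, the chain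
     ... <= alpha_3 <= beta_3 <= alpha_2 <= beta_2 <= alpha_1 <= beta_1.
   It alternates, so it ends either in alpha_m <= beta_m or in beta_(m+1) <= alpha_m. *)
definition interlacing_chain :: "real list \<Rightarrow> real list \<Rightarrow> bool" where
  "interlacing_chain as bs \<longleftrightarrow>
     (length bs = length as \<or> length bs = length as + 1) \<and>
     (\<forall>i < length as. as ! i \<le> bs ! i) \<and>
     (\<forall>i. i + 1 < length bs \<longrightarrow> bs ! (i + 1) \<le> as ! i)"

definition interlaces :: "real poly \<Rightarrow> real poly \<Rightarrow> bool" (infix "\<prec>\<^sub>I" 50) where
  "f \<prec>\<^sub>I g \<longleftrightarrow> real_rooted f \<and> real_rooted g \<and>
     (f = 0 \<or> g = 0 \<or>
      (lead_coeff f > 0 \<and> lead_coeff g > 0 \<and> interlacing_chain (zeros_desc f) (zeros_desc g)))"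

(* Q(x) - t x^r as a formal power series in x over R[t]: the coefficients of Q are embedded as
   constant polynomials in t, and [:0, 1:] is the indeterminate t. *)
definition denominator_series :: "real poly \<Rightarrow> nat \<Rightarrow> real poly fps" where
  "denominator_series Q r =
     fps_of_poly (map_poly (\<lambda>c. [:c:]) Q) - fps_const [:0, 1:] * fps_X ^ r"

end

(*
  Write Q(x) = c (1 - a_1 x) ... (1 - a_d x) with all a_j > 0, put F = 1 / (Q(x) - t x^r) and
  y_j = (1 - a_1 x) ... (1 - a_j x) F. Then y_(j-1) = y_j + a_j x y_(j-1) and
  c y_d = 1 + t x^r F. Evaluate the coefficients at a point t = z of the upper half plane. By
  induction on n, the complex numbers
    q_(n-r), ..., q_(n-1), q_n = y_0[n], y_1[n], ..., y_d[n]
  run counterclockwise through a sector of opening arg z: passing to n + 1 drops the first number,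
  appends a positive multiple of z times the next one, and then inserts positive combinations of
  neighbours.
  In particular Im (q_(n+1)(z) conj(q_n(z))) >= 0, and if d > 0 no q_n vanishes in the upper half
  plane, so q_n is real-rooted; it is positive on [0, oo).

  The sign condition yields interlacing because arg f(x + i e) tends to pi times the number of
  zeros of f greater than x as e tends to 0 from above: for real-rooted f and g, the number of
  zeros of g beyond any x exceeds that of f by 0 or 1.
*)
theory Submission
  imports Defs
begin

section \<open>The argument of a real-rooted polynomial in the upper half plane\<close>

text \<open>For e > 0, \<open>pi / 2 - arctan ((s - a) / e)\<close> is the argument in (0, pi) of s
  - a + i e. The sum is an argument of the product of these factors that is continuous in s, not
  reduced modulo 2 pi.\<close>

definition angle_sum :: "real \<Rightarrow> real list \<Rightarrow> real \<Rightarrow> real" where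
  "angle_sum e xs s = (\<Sum>a\<leftarrow>xs. pi / 2 - arctan ((s - a) / e))"

lemma Complex_eq_cis_arctan:
  assumes "e > 0"
  shows "Complex (s - a) e =
    of_real (e * sqrt (1 + ((s - a) / e)\<^sup>2)) * cis (pi / 2 - arctan ((s - a) / e))"
proof -
  define u where "u = (s - a) / e"
  have *: "sqrt (1 + u\<^sup>2) \<noteq> 0"
    by (smt (verit) real_sqrt_eq_zero_cancel_iff zero_le_power2)
  have "of_real (e * sqrt (1 + u\<^sup>2)) * cis (pi / 2 - arctan u) = Complex (e * u) e"
    using * by (simp add: complex_eq_iff cos_diff sin_diff sin_arctan cos_arctan)
  with assms show ?thesis
    by (simp add: u_def)
qed

lemma prod_linear_polar:
  assumes "e > 0"
  obtains \<rho> where "\<rho> > 0"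
    "(\<Prod>a\<leftarrow>xs. Complex s e - of_real a) = of_real \<rho> * cis (angle_sum e xs s)"
proof -
  have "\<exists>\<rho>>0. (\<Prod>a\<leftarrow>xs. Complex s e - of_real a) = of_real \<rho> * cis (angle_sum e xs s)"
  proof (induction xs)
    case Nil
    then show ?case
      by (intro exI[of _ 1]) (simp add: angle_sum_def)
  next
    case (Cons a xs)
    then obtain \<rho> where \<rho>: "\<rho> > 0"
      "(\<Prod>a\<leftarrow>xs. Complex s e - of_real a) = of_real \<rho> * cis (angle_sum e xs s)"
      by blast
    define k where "k = e * sqrt (1 + ((s - a) / e)\<^sup>2)"
    have "k > 0"
      using assms by (auto simp: k_def intro!: mult_pos_pos add_pos_nonneg)
    moreover have "Complex s e - of_real a = of_real k * cis (pi / 2 - arctan ((s - a) / e))"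
      unfolding k_def Complex_eq_cis_arctan[OF assms, symmetric] by (simp add: complex_eq_iff)
    ultimately show ?case
      using \<rho> by (intro exI[of _ "k * \<rho>"]) (simp add: angle_sum_def cis_mult[symmetric])
  qed
  with that show thesis by blast
qed

lemma continuous_on_angle_sum: "continuous_on S (angle_sum e xs)"
  unfolding angle_sum_def divide_inverse
  by (induction xs) (auto intro!: continuous_intros)

lemma angle_sum_at_top:
  assumes "e > 0"
  shows "(angle_sum e xs \<longlongrightarrow> 0) at_top"
proof (induction xs)
  case (Cons a xs)
  have "filterlim (\<lambda>s. (1 / e) * (-a + s)) at_top at_top"
    using assms
    by (intro filterlim_tendsto_pos_mult_at_top[OF tendsto_const]
          filterlim_tendsto_add_at_top[OF tendsto_const] filterlim_ident) auto
  then have "filterlim (\<lambda>s. (s - a) / e) at_top at_top"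
    by (simp add: field_simps)
  then have "((\<lambda>s. pi / 2 - arctan ((s - a) / e)) \<longlongrightarrow> pi / 2 - pi / 2) at_top"
    by (intro tendsto_intros filterlim_compose[OF tendsto_arctan_at_top])
  from tendsto_add[OF this Cons] show ?case
    by (simp add: angle_sum_def[abs_def])
qed (simp add: angle_sum_def[abs_def])

text \<open>As e tends to 0, s - a + i e approaches the negative axis if a > s and the positive axis
  if a < s, contributing pi or 0; for a = s its argument would stay pi / 2.\<close>

lemma angle_sum_at_right_0:
  assumes "s \<notin> set xs"
  shows "((\<lambda>e. angle_sum e xs s) \<longlongrightarrow> pi * real (length (filter (\<lambda>a. a > s) xs))) (at_right 0)"
  using assms
proof (induction xs)
  case (Cons a xs)
  have inv: "filterlim (\<lambda>e::real. inverse e) at_top (at_right 0)"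
    by (rule filterlim_inverse_at_top_right)
  have "((\<lambda>e. pi / 2 - arctan ((s - a) / e)) \<longlongrightarrow> (if a > s then pi else 0)) (at_right 0)"
  proof (cases "a > s")
    case True
    have "filterlim (\<lambda>e. (s - a) * inverse e) at_bot (at_right 0)"
      using True by (intro filterlim_tendsto_neg_mult_at_bot[OF tendsto_const _ inv]) auto
    then have "((\<lambda>e. pi / 2 - arctan ((s - a) * inverse e)) \<longlongrightarrow> pi / 2 - (- (pi / 2))) (at_right 0)"
      by (intro tendsto_intros filterlim_compose[OF tendsto_arctan_at_bot])
    then show ?thesis
      using True by (simp add: field_simps)
  next
    case False
    have "filterlim (\<lambda>e. (s - a) * inverse e) at_top (at_right 0)"
      using False Cons.prems
      by (intro filterlim_tendsto_pos_mult_at_top[OF tendsto_const _ inv]) auto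
    then have "((\<lambda>e. pi / 2 - arctan ((s - a) * inverse e)) \<longlongrightarrow> pi / 2 - pi / 2) (at_right 0)"
      by (intro tendsto_intros filterlim_compose[OF tendsto_arctan_at_top])
    then show ?thesis
      using False by (simp add: field_simps)
  qed
  from tendsto_add[OF this Cons.IH] Cons.prems show ?case
    by (cases "a > s") (simp_all add: angle_sum_def algebra_simps)
qed (simp add: angle_sum_def)

(* The difference of the arguments vanishes as s tends to infinity and its sine is nonnegative,
   so by the intermediate value theorem it can leave [0, pi] in neither direction. *)
lemma angle_sum_diff_bounds:
  assumes e: "e > 0"
    and sin: "\<And>s. sin (angle_sum e ys s - angle_sum e xs s) \<ge> 0"
  shows "angle_sum e ys s - angle_sum e xs s \<in> {0..pi}"
proof -
  define h where "h = (\<lambda>s. angle_sum e ys s - angle_sum e xs s)"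
  have cont: "continuous_on S h" for S
    unfolding h_def by (intro continuous_on_diff continuous_on_angle_sum)
  have lim: "(h \<longlongrightarrow> 0) at_top"
    unfolding h_def using tendsto_diff[OF angle_sum_at_top[OF e, of ys] angle_sum_at_top[OF e, of xs]]
    by simp
  have h_sin: "sin (h s) \<ge> 0" for s
    using sin by (simp add: h_def)
  have "h s \<ge> 0"
  proof (rule ccontr)
    assume neg: "\<not> h s \<ge> 0"
    \<comment> \<open>Clipping keeps \<open>v\<close> in (-pi, 0), where sine is negative;
      \<open>h\<close> must pass through \<open>v\<close> on its way from \<open>h s\<close> up
      towards 0.\<close>
    define v where "v = max (h s) (- pi / 2)"
    have v: "h s \<le> v" "v < 0" "-pi < v"
      using neg pi_gt_zero by (auto simp: v_def max_def)
    have "eventually (\<lambda>s'. h s' > v \<and> s' \<ge> s) at_top"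
      using order_tendstoD(1)[OF lim v(2)] eventually_ge_at_top[of s] by eventually_elim auto
    then obtain s' where "h s' > v" "s' \<ge> s"
      by (auto simp: eventually_at_top_linorder)
    with v IVT'[of h s v s'] cont obtain s2 where "h s2 = v"
      by force
    with h_sin[of s2] v sin_lt_zero[of "v + 2 * pi"] show False
      by simp
  qed
  moreover have "h s \<le> pi"
  proof (rule ccontr)
    assume big: "\<not> h s \<le> pi"
    define v where "v = min (h s) (3 * pi / 2)"
    have v: "h s \<ge> v" "v > pi" "v < 2 * pi" "v > 0"
      using big pi_gt_zero by (auto simp: v_def min_def)
    have "eventually (\<lambda>s'. h s' < v \<and> s' \<ge> s) at_top"
      using order_tendstoD(2)[OF lim v(4)] eventually_ge_at_top[of s] by eventually_elim auto
    then obtain s' where "h s' < v" "s' \<ge> s"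
      by (auto simp: eventually_at_top_linorder)
    with v IVT2'[of h s' v s] cont obtain s2 where "h s2 = v"
      by force
    with h_sin[of s2] v sin_lt_zero[of v] show False
      by simp
  qed
  ultimately show ?thesis
    by (simp add: h_def)
qed

section \<open>From arguments to counts of zeros and to the interlacing chain\<close>

lemma count_greater_bounds:
  assumes uhp: "\<And>z. Im z > 0 \<Longrightarrow>
      Im ((\<Prod>b\<leftarrow>ys. z - of_real b) * cnj (\<Prod>a\<leftarrow>xs. z - of_real a)) \<ge> 0"
  shows "length (filter (\<lambda>a. a > x) xs) \<le> length (filter (\<lambda>b. b > x) ys)"
    and "length (filter (\<lambda>b. b > x) ys) \<le> Suc (length (filter (\<lambda>a. a > x) xs))"
proof -
  have angle: "angle_sum e ys s - angle_sum e xs s \<in> {0..pi}" if e: "e > 0" for e s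
  proof (rule angle_sum_diff_bounds[OF e])
    fix s
    obtain \<rho> where \<rho>: "\<rho> > 0"
      "(\<Prod>a\<leftarrow>xs. Complex s e - of_real a) = of_real \<rho> * cis (angle_sum e xs s)"
      using prod_linear_polar[OF e] by blast
    obtain \<sigma> where \<sigma>: "\<sigma> > 0"
      "(\<Prod>a\<leftarrow>ys. Complex s e - of_real a) = of_real \<sigma> * cis (angle_sum e ys s)"
      using prod_linear_polar[OF e] by blast
    have "Im ((\<Prod>b\<leftarrow>ys. Complex s e - of_real b) * cnj (\<Prod>a\<leftarrow>xs. Complex s e - of_real a))
      = \<sigma> * \<rho> * sin (angle_sum e ys s - angle_sum e xs s)"
      unfolding \<rho>(2) \<sigma>(2) by (simp add: sin_diff algebra_simps)
    moreover have "Im ((\<Prod>b\<leftarrow>ys. Complex s e - of_real b) * cnj (\<Prod>a\<leftarrow>xs. Complex s e - of_real a)) \<ge> 0"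
      using e by (intro uhp) simp
    ultimately have "0 \<le> \<sigma> * \<rho> * sin (angle_sum e ys s - angle_sum e xs s)"
      by linarith
    moreover have "\<sigma> * \<rho> > 0"
      using \<rho>(1) \<sigma>(1) by simp
    ultimately show "sin (angle_sum e ys s - angle_sum e xs s) \<ge> 0"
      by (simp add: zero_le_mult_iff)
  qed
  \<comment> \<open>The limit of \<open>angle_sum\<close> is available only away from the zeros, so
    x is moved right to a point \<open>y\<close> before the next zero, which changes no count. The
    element x + 1 keeps \<open>Min M\<close> meaningful.\<close>
  obtain y where y: "y > x" "\<And>a. a \<in> set xs \<union> set ys \<Longrightarrow> a > x \<longleftrightarrow> a > y" "y \<notin> set xs \<union> set ys"
  proof -
    define M where "M = insert (x + 1) {a \<in> set xs \<union> set ys. a > x}"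
    have M: "finite M" "M \<noteq> {}"
      by (auto simp: M_def)
    define y where "y = (x + Min M) / 2"
    have "Min M > x"
      using M by (auto simp: M_def)
    then have y: "x < y" "y < Min M"
      by (auto simp: y_def)
    have "y < a" if "a \<in> set xs \<union> set ys" "a > x" for a
      using Min_le[OF M(1), of a] that y by (auto simp: M_def)
    with y that[of y] show thesis
      by force
  qed
  have eqs: "filter (\<lambda>a. a > x) xs = filter (\<lambda>a. a > y) xs" "filter (\<lambda>a. a > x) ys = filter (\<lambda>a. a > y) ys"
    using y(2) by (auto intro!: filter_cong)
  have lim: "((\<lambda>e. angle_sum e ys y - angle_sum e xs y) \<longlongrightarrow>
      pi * real (length (filter (\<lambda>a. a > y) ys)) - pi * real (length (filter (\<lambda>a. a > y) xs))) (at_right 0)"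
    using y(3) by (intro tendsto_diff angle_sum_at_right_0) auto
  have ev: "eventually (\<lambda>e. angle_sum e ys y - angle_sum e xs y \<in> {0..pi}) (at_right 0)"
    using angle by (auto simp: eventually_at_right_less intro: eventually_mono[OF eventually_at_right_less])
  have "0 \<le> pi * real (length (filter (\<lambda>a. a > y) ys)) - pi * real (length (filter (\<lambda>a. a > y) xs))"
    by (rule tendsto_lowerbound[OF lim]) (use ev in \<open>auto elim: eventually_mono\<close>)
  then have "pi * real (length (filter (\<lambda>a. a > y) xs)) \<le> pi * real (length (filter (\<lambda>a. a > y) ys))"
    by simp
  then show "length (filter (\<lambda>a. a > x) xs) \<le> length (filter (\<lambda>b. b > x) ys)"
    unfolding eqs by simp
  have "pi * real (length (filter (\<lambda>a. a > y) ys)) - pi * real (length (filter (\<lambda>a. a > y) xs)) \<le> pi"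
    by (rule tendsto_upperbound[OF lim]) (use ev in \<open>auto elim: eventually_mono\<close>)
  then have "pi * real (length (filter (\<lambda>a. a > y) ys)) \<le> pi * real (Suc (length (filter (\<lambda>a. a > y) xs)))"
    by (simp add: algebra_simps)
  then have "real (length (filter (\<lambda>a. a > y) ys)) \<le> real (Suc (length (filter (\<lambda>a. a > y) xs)))"
    by (subst (asm) mult_le_cancel_left_pos) auto
  then show "length (filter (\<lambda>b. b > x) ys) \<le> Suc (length (filter (\<lambda>a. a > x) xs))"
    unfolding eqs by simp
qed

text \<open>In a decreasing list the entries above x form an initial segment, and the count is the
  index at which it ends.\<close>

lemma nth_gt_iff_count_greater:
  fixes xs :: "real list"
  assumes "sorted_wrt (\<ge>) xs" "i < length xs"
  shows "xs ! i > x \<longleftrightarrow> i < length (filter (\<lambda>a. a > x) xs)"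
  using assms
proof (induction xs arbitrary: i)
  case (Cons a xs)
  show ?case
  proof (cases "a > x")
    case True
    with Cons show ?thesis
      by (cases i) auto
  next
    case False
    then have "\<forall>b\<in>set (a # xs). \<not> b > x"
      using Cons.prems by auto
    then have "filter (\<lambda>a. a > x) (a # xs) = []" "\<not> (a # xs) ! i > x"
      using Cons.prems(2) by (auto simp: filter_empty_conv simp del: nth_Cons_0) (metis nth_mem set_ConsD length_Cons not_less)
    then show ?thesis by (metis list.size(3) not_less_zero)
  qed
qed simp

text \<open>Thresholds at the entries suffice: \<open>le\<close> is tested at \<open>ys ! i\<close>
  and \<open>ge\<close> at \<open>xs ! i\<close>. As the counts are strict, a violated inequality
  would put an entry strictly above itself.\<close>

lemma interlacing_chainI:
  fixes xs ys :: "real list"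
  assumes sorted: "sorted_wrt (\<ge>) xs" "sorted_wrt (\<ge>) ys"
    and le: "\<And>x. length (filter (\<lambda>a. a > x) xs) \<le> length (filter (\<lambda>b. b > x) ys)"
    and ge: "\<And>x. length (filter (\<lambda>b. b > x) ys) \<le> Suc (length (filter (\<lambda>a. a > x) xs))"
  shows "interlacing_chain xs ys"
proof -
  \<comment> \<open>A point below every entry, so that the counts there are the full lengths; the
    inserted 0 covers empty lists.\<close>
  define m where "m = Min (insert 0 (set xs \<union> set ys)) - 1"
  have "m < a" if "a \<in> set xs \<union> set ys" for a
  proof -
    have "Min (insert 0 (set xs \<union> set ys)) \<le> a"
      using that by (intro Min_le) auto
    then show ?thesis by (simp add: m_def)
  qed
  then have "filter (\<lambda>a. a > m) xs = xs" "filter (\<lambda>a. a > m) ys = ys"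
    by auto
  with le[of m] ge[of m] have len: "length xs \<le> length ys" "length ys \<le> Suc (length xs)"
    by simp_all
  moreover have "xs ! i \<le> ys ! i" if "i < length xs" for i
    using nth_gt_iff_count_greater[OF sorted(1), of i "ys ! i"]
      nth_gt_iff_count_greater[OF sorted(2), of i "ys ! i"] le[of "ys ! i"] that len
    by (metis dual_order.strict_trans1 not_le order_less_irrefl)
  moreover have "ys ! (i + 1) \<le> xs ! i" if "i + 1 < length ys" for i
  proof (rule ccontr)
    assume "\<not> ?thesis"
    then have "i + 1 < length (filter (\<lambda>b. b > xs ! i) ys)"
      using nth_gt_iff_count_greater[OF sorted(2) that, of "xs ! i"] by simp
    with ge[of "xs ! i"] have "i < length (filter (\<lambda>b. b > xs ! i) xs)"
      by simp
    with nth_gt_iff_count_greater[OF sorted(1), of i "xs ! i"] len that show False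
      by simp
  qed
  ultimately show ?thesis
    by (auto simp: interlacing_chain_def)
qed

section \<open>Real-rooted polynomials\<close>

text \<open>Generic in the field: the complex instance locates zeros, the real instance gives signs
  on the real axis.\<close>

definition real_poly_eval :: "'a::real_field \<Rightarrow> real poly \<Rightarrow> 'a" where
  "real_poly_eval z p = poly (map_poly of_real p) z"

lemma real_poly_eval_simps [simp]:
  "real_poly_eval z 0 = 0" "real_poly_eval z 1 = 1"
  "real_poly_eval z (pCons a p) = of_real a + z * real_poly_eval z p"
  by (simp_all add: real_poly_eval_def map_poly_pCons)

lemma map_poly_of_real_mult:
  "map_poly of_real (p * q) = (map_poly of_real p * map_poly of_real q :: 'a::real_field poly)"
  by (rule poly_eqI) (simp add: coeff_map_poly coeff_mult)

lemma real_poly_eval_add: "real_poly_eval z (p + q) = real_poly_eval z p + real_poly_eval z q"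
proof -
  have "map_poly of_real (p + q) = (map_poly of_real p + map_poly of_real q :: 'a poly)"
    by (rule poly_eqI) (simp add: coeff_map_poly)
  then show ?thesis by (simp add: real_poly_eval_def)
qed

lemma real_poly_eval_minus: "real_poly_eval z (- p) = - real_poly_eval z p"
  using real_poly_eval_add[of z "- p" p] by (simp add: eq_neg_iff_add_eq_0)

lemma real_poly_eval_diff: "real_poly_eval z (p - q) = real_poly_eval z p - real_poly_eval z q"
  using real_poly_eval_add[of z p "- q"] by (simp add: real_poly_eval_minus)

lemma real_poly_eval_mult: "real_poly_eval z (p * q) = real_poly_eval z p * real_poly_eval z q"
  by (simp add: real_poly_eval_def map_poly_of_real_mult)

lemma real_poly_eval_smult: "real_poly_eval z (smult c p) = of_real c * real_poly_eval z p"
  by (simp add: real_poly_eval_def map_poly_smult)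

lemma real_poly_eval_sum: "real_poly_eval z (\<Sum>i\<in>A. f i) = (\<Sum>i\<in>A. real_poly_eval z (f i))"
  by (induction A rule: infinite_finite_induct) (simp_all add: real_poly_eval_add)

lemma real_poly_eval_prod_list:
  "real_poly_eval z (\<Prod>a\<leftarrow>xs. f a) = (\<Prod>a\<leftarrow>xs. real_poly_eval z (f a))"
  by (induction xs) (simp_all add: real_poly_eval_mult)

lemma real_poly_eval_of_real: "real_poly_eval (of_real x :: 'a::real_field) p = of_real (poly p x)"
  by (induction p) simp_all

lemma real_poly_eval_real: "real_poly_eval x p = poly p x" for x :: real
  using real_poly_eval_of_real[of x p, where 'a = real] by simp

lemma real_poly_eval_cnj: "real_poly_eval (cnj z) p = cnj (real_poly_eval z p)"
  by (induction p) simp_all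

text \<open>Induction on the degree: the fundamental theorem of algebra supplies a complex zero,
  which is real by assumption, and its linear factor is split off.\<close>

lemma real_poly_decompose_multiset:
  fixes p :: "real poly"
  assumes "\<And>z::complex. real_poly_eval z p = 0 \<Longrightarrow> z \<in> \<real>" and "p \<noteq> 0"
  shows "smult (lead_coeff p) (\<Prod>x\<in>#proots p. [:-x, 1:]) = p"
  using assms
proof (induction "degree p" arbitrary: p)
  case 0
  then obtain c where "p = [:c:]"
    by (metis degree_eq_zeroE)
  then show ?case
    by simp
next
  case (Suc n)
  have "degree (map_poly complex_of_real p) = Suc n"
    using Suc.hyps(2) Suc.prems(2) by (subst map_poly_degree_eq) simp_all
  then have "\<not> constant (poly (map_poly complex_of_real p))"
    by (simp add: constant_degree)
  then obtain z :: complex where z: "real_poly_eval z p = 0"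
    using fundamental_theorem_of_algebra unfolding real_poly_eval_def by blast
  with Suc.prems(1) obtain x where "z = of_real x"
    by (auto elim: Reals_cases)
  with z have "poly p x = 0"
    by (simp add: real_poly_eval_of_real)
  then obtain q where q: "p = [:-x, 1:] * q"
    by (auto simp: poly_eq_0_iff_dvd)
  with Suc.prems(2) have "q \<noteq> 0"
    by auto
  have "degree p = Suc (degree q)"
    using \<open>q \<noteq> 0\<close> unfolding q by (subst degree_mult_eq) auto
  moreover have "z \<in> \<real>" if "real_poly_eval z q = 0" for z :: complex
    using Suc.prems(1)[of z] that unfolding q real_poly_eval_mult by simp
  ultimately have IH: "smult (lead_coeff q) (\<Prod>x\<in>#proots q. [:-x, 1:]) = q"
    using Suc.hyps \<open>q \<noteq> 0\<close> by simp
  have "lead_coeff p = lead_coeff q"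
    unfolding q by (subst lead_coeff_mult) simp
  moreover have "proots p = add_mset x (proots q)"
    using \<open>q \<noteq> 0\<close> unfolding q by (subst proots_mult) auto
  ultimately have "smult (lead_coeff p) (\<Prod>x\<in>#proots p. [:-x, 1:]) =
      [:-x, 1:] * smult (lead_coeff q) (\<Prod>x\<in>#proots q. [:-x, 1:])"
    by (simp only: image_mset_add_mset prod_mset.add_mset mult_smult_right)
  with IH q show ?case
    by simp
qed

lemma mset_zeros_desc: "mset (zeros_desc p) = proots p"
  by (simp add: zeros_desc_def)

lemma sorted_zeros_desc: "sorted_wrt (\<ge>) (zeros_desc p)"
  by (simp add: zeros_desc_def sorted_wrt_rev)

lemma real_rooted_iff:
  "p \<noteq> 0 \<Longrightarrow> real_rooted p \<longleftrightarrow> (\<forall>z::complex. real_poly_eval z p = 0 \<longrightarrow> z \<in> \<real>)"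
  by (simp add: real_rooted_def real_poly_eval_def)

lemma real_poly_eval_real_rooted:
  fixes z :: complex
  assumes "real_rooted p" "p \<noteq> 0"
  shows "real_poly_eval z p = of_real (lead_coeff p) * (\<Prod>a\<leftarrow>zeros_desc p. z - of_real a)"
proof -
  have "p = smult (lead_coeff p) (\<Prod>x\<in>#proots p. [:-x, 1:])"
    by (rule real_poly_decompose_multiset[symmetric]) (use assms in \<open>auto simp: real_rooted_iff\<close>)
  also have "\<dots> = smult (lead_coeff p) (\<Prod>a\<leftarrow>zeros_desc p. [:-a, 1:])"
    by (simp flip: mset_zeros_desc prod_mset_prod_list mset_map)
  finally have "real_poly_eval z p = real_poly_eval z (smult (lead_coeff p) (\<Prod>a\<leftarrow>zeros_desc p. [:-a, 1:]))"
    by (rule arg_cong)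
  then show ?thesis
    by (simp add: real_poly_eval_smult real_poly_eval_prod_list)
qed

lemma Im_mult_of_real: "Im (of_real c * w) = c * Im w"
  by simp

text \<open>For nonzero f and g, both values are positive multiples of the products over the zeros,
  so the sign condition passes to these products.\<close>

lemma interlacesI:
  assumes "real_rooted f" "real_rooted g"
    and "f \<noteq> 0 \<Longrightarrow> lead_coeff f > 0" "g \<noteq> 0 \<Longrightarrow> lead_coeff g > 0"
    and im: "\<And>z::complex. Im z > 0 \<Longrightarrow> Im (real_poly_eval z g * cnj (real_poly_eval z f)) \<ge> 0"
  shows "f \<prec>\<^sub>I g"
proof (cases "f = 0 \<or> g = 0")
  case True
  with assms show ?thesis
    by (auto simp: interlaces_def)
next
  case False
  have "Im ((\<Prod>b\<leftarrow>zeros_desc g. z - of_real b) * cnj (\<Prod>a\<leftarrow>zeros_desc f. z - of_real a)) \<ge> 0"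
    if z: "Im z > 0" for z
  proof -
    define v where "v = (\<Prod>b\<leftarrow>zeros_desc g. z - of_real b)"
    define u where "u = (\<Prod>a\<leftarrow>zeros_desc f. z - of_real a)"
    have "real_poly_eval z g * cnj (real_poly_eval z f) =
        of_real (lead_coeff g * lead_coeff f) * (v * cnj u)"
      using False assms(1,2) by (simp add: real_poly_eval_real_rooted u_def v_def)
    with im[OF z] have "lead_coeff g * lead_coeff f * Im (v * cnj u) \<ge> 0"
      by (simp only: Im_mult_of_real)
    moreover have "lead_coeff g * lead_coeff f > 0"
      using False assms(3,4) by simp
    ultimately have "Im (v * cnj u) \<ge> 0"
      by (simp only: zero_le_mult_iff) linarith
    then show ?thesis
      by (simp only: u_def v_def)
  qed
  then have "interlacing_chain (zeros_desc f) (zeros_desc g)"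
    by (intro interlacing_chainI sorted_zeros_desc count_greater_bounds)
  with False assms show ?thesis
    by (simp add: interlaces_def)
qed

lemma lead_coeff_pos_if_pos_on_pos:
  fixes p :: "real poly"
  assumes "\<And>x. x > 0 \<Longrightarrow> poly p x > 0"
  shows "lead_coeff p > 0"
proof (rule ccontr)
  assume "\<not> ?thesis"
  moreover have "p \<noteq> 0"
    using assms[of 1] by auto
  ultimately have "lead_coeff (- p) > 0"
    by (simp add: less_le)
  then obtain n where n: "\<And>x. x \<ge> n \<Longrightarrow> poly (- p) x \<ge> lead_coeff (- p)"
    using poly_pinfty_gt_lc by blast
  have "poly p (max n 1) > 0"
    by (rule assms) simp
  moreover have "poly (- p) (max n 1) > 0"
    using n[of "max n 1"] \<open>lead_coeff (- p) > 0\<close> by linarith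
  ultimately show False
    by simp
qed

text \<open>The \<open>as\<close> are the reciprocals of the zeros; factors with constant term 1 are
  the form needed for power series.\<close>

lemma positive_rooted_factorization:
  fixes Q :: "real poly"
  assumes "poly Q 0 \<noteq> 0"
    and roots: "\<And>z::complex. real_poly_eval z Q = 0 \<Longrightarrow> z \<in> \<real> \<and> Re z > 0"
  obtains as where "Q = smult (poly Q 0) (\<Prod>a\<leftarrow>as. [:1, -a:])" "\<forall>a\<in>set as. a > 0"
proof -
  have "Q \<noteq> 0"
    using assms(1) by auto
  have pos: "\<forall>x\<in>set (zeros_desc Q). x > 0"
  proof
    fix x assume "x \<in> set (zeros_desc Q)"
    then have "poly Q x = 0"
      using \<open>Q \<noteq> 0\<close> by (simp add: zeros_desc_def)
    then show "x > 0"
      using roots[of "of_real x"] by (simp add: real_poly_eval_of_real)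
  qed
  define as where "as = map inverse (zeros_desc Q)"
  \<comment> \<open>The scalar is left unspecified here; since every factor 1 - a x equals 1 at 0,
    evaluating at 0 later identifies it.\<close>
  have scale: "\<exists>c. (\<Prod>x\<leftarrow>xs. [:-x, 1:]) = smult c (\<Prod>x\<leftarrow>xs. [:1, - inverse x:])"
    if "\<forall>x\<in>set xs. x > 0" for xs :: "real list"
    using that
  proof (induction xs)
    case (Cons x xs)
    then obtain c where "(\<Prod>x\<leftarrow>xs. [:-x, 1:]) = smult c (\<Prod>x\<leftarrow>xs. [:1, - inverse x:])"
      by auto
    moreover have "[:-x, 1:] = smult (- x) [:1, - inverse x:]"
      using Cons.prems by simp
    ultimately have "(\<Prod>x\<leftarrow>x # xs. [:-x, 1:]) = smult (-x * c) (\<Prod>x\<leftarrow>x # xs. [:1, - inverse x:])"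
      by (simp only: list.map prod_list.Cons mult_smult_left mult_smult_right smult_smult
          mult.commute)
    then show ?case by blast
  qed (auto intro: exI[of _ 1])
  have "Q = smult (lead_coeff Q) (\<Prod>x\<in>#proots Q. [:-x, 1:])"
    by (rule real_poly_decompose_multiset[symmetric]) (use roots \<open>Q \<noteq> 0\<close> in auto)
  also have "\<dots> = smult (lead_coeff Q) (\<Prod>a\<leftarrow>zeros_desc Q. [:-a, 1:])"
    by (simp flip: mset_zeros_desc prod_mset_prod_list mset_map)
  finally obtain c where c: "Q = smult c (\<Prod>a\<leftarrow>as. [:1, -a:])"
    using scale[OF pos] by (auto simp: as_def o_def)
  have "poly (\<Prod>a\<leftarrow>as. [:1, -a:]) 0 = 1"
    by (induction as) auto
  with c have "poly Q 0 = c"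
    by (metis mult.right_neutral poly_smult)
  with c pos that[of as] show thesis
    by (auto simp: as_def)
qed

section \<open>Coefficients of the power series at a point of the upper half plane\<close>

(* For Im z > 0 and nonzero f, g: arg f <= arg g <= arg f + arg z. Both inequalities are additive
   in f and in g, so the relation is stable under nonnegative combinations on either side. *)
definition in_sector :: "complex \<Rightarrow> complex \<Rightarrow> complex \<Rightarrow> bool" where
  "in_sector z f g \<longleftrightarrow> Im (g * cnj f) \<ge> 0 \<and> Im (z * f * cnj g) \<ge> 0"

lemma in_sector_0 [simp]: "in_sector z 0 g" "in_sector z f 0"
  by (simp_all add: in_sector_def)

lemma in_sector_refl: "Im z > 0 \<Longrightarrow> in_sector z f f"
  by (simp add: in_sector_def complex_mult_cnj mult.assoc)

lemma in_sector_add_right: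
  assumes "in_sector z f g" "in_sector z f h" "a \<ge> 0"
  shows "in_sector z f (g + of_real a * h)"
proof -
  have "(g + of_real a * h) * cnj f = g * cnj f + of_real a * (h * cnj f)"
    "z * f * cnj (g + of_real a * h) = z * f * cnj g + of_real a * (z * f * cnj h)"
    by (simp_all add: algebra_simps)
  with assms show ?thesis
    unfolding in_sector_def by (simp only: plus_complex.sel Im_mult_of_real) simp
qed

lemma in_sector_add_left:
  assumes "in_sector z f h" "in_sector z g h" "a \<ge> 0"
  shows "in_sector z (f + of_real a * g) h"
proof -
  have "h * cnj (f + of_real a * g) = h * cnj f + of_real a * (h * cnj g)"
    "z * (f + of_real a * g) * cnj h = z * f * cnj h + of_real a * (z * g * cnj h)"
    by (simp_all add: algebra_simps)
  with assms show ?thesis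
    unfolding in_sector_def by (simp only: plus_complex.sel Im_mult_of_real) simp
qed

lemma cmod_power2_eq: "(of_real (cmod w))\<^sup>2 = w * cnj w"
  by (metis complex_norm_square of_real_power)

text \<open>The two inequalities trade places: the new first one is the old second one, and the new
  second one is the old first one times the square of \<open>cmod z\<close>, both up to the factor
  k.\<close>

lemma in_sector_rotate:
  assumes "in_sector z f g" "k \<ge> 0"
  shows "in_sector z g (of_real k * (z * f))"
proof -
  have "of_real k * (z * f) * cnj g = of_real k * (z * f * cnj g)"
    "z * g * cnj (of_real k * (z * f)) = of_real (k * (cmod z)\<^sup>2) * (g * cnj f)"
    by (simp_all add: cmod_power2_eq algebra_simps)
  with assms show ?thesis
    unfolding in_sector_def by (simp only: Im_mult_of_real) simp
qed

text \<open>Each entry lies in the sector of the head, so rotating the head by z moves it past all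
  of them. Since 0 is related to everything, \<open>in_sector\<close> is not transitive, and
  \<open>sorted_wrt\<close> must carry the relation for all pairs.\<close>

lemma sorted_wrt_in_sector_rotate:
  assumes "sorted_wrt (in_sector z) xs" "xs \<noteq> []" "Im z > 0" "k \<ge> 0"
  shows "sorted_wrt (in_sector z) (xs @ [of_real k * (z * hd xs)])"
  using assms by (cases xs) (auto simp: sorted_wrt_append intro: in_sector_rotate in_sector_refl)

section \<open>The tower of partial products and its coefficients\<close>

definition lin_factor :: "real \<Rightarrow> 'a::real_field fps" where
  "lin_factor a = 1 - fps_const (of_real a) * fps_X"

definition lin_prod :: "real list \<Rightarrow> 'a::real_field fps" where
  "lin_prod as = (\<Prod>a\<leftarrow>as. lin_factor a)"

lemma lin_prod_simps [simp]: "lin_prod [] = 1" "lin_prod (a # as) = lin_factor a * lin_prod as"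
  by (simp_all add: lin_prod_def)

text \<open>For G = F these are the series y_0, ..., y_d of the overview; the last one is
  \<open>lin_prod as * G\<close>.\<close>

fun tower :: "real list \<Rightarrow> 'a::real_field fps \<Rightarrow> 'a fps list" where
  "tower [] G = [G]"
| "tower (a # as) G = G # tower as (lin_factor a * G)"

lemma tower_neq_Nil [simp]: "tower as G \<noteq> []"
  by (cases as) auto

lemma hd_tower [simp]: "hd (tower as G) = G"
  by (cases as) auto

lemma lin_factor_nth_0 [simp]: "lin_factor a $ 0 = 1"
  by (simp add: lin_factor_def)

text \<open>The identity y_(j-1) = y_j + a_j x y_(j-1), read off at one coefficient.\<close>

lemma nth_Suc_eq_lin_factor: "G $ Suc n = (lin_factor a * G) $ Suc n + of_real a * G $ n"
proof -
  have "lin_factor a * G = G - fps_const (of_real a) * (fps_X * G)"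
    by (simp add: lin_factor_def algebra_simps)
  then show ?thesis
    by simp
qed

lemma tower_nth_0: "H \<in> set (tower as G) \<Longrightarrow> H $ 0 = G $ 0"
  by (induction as arbitrary: G) auto

text \<open>Additivity in each argument relates the combination to all earlier and later entries;
  against f and g themselves it also takes reflexivity, hence Im z > 0.\<close>

lemma sorted_wrt_in_sector_insert:
  assumes "sorted_wrt (in_sector z) (pre @ f # g # ys)" "a \<ge> 0" "Im z > 0"
  shows "sorted_wrt (in_sector z) (pre @ f # (g + of_real a * f) # g # ys)"
proof -
  have pre: "in_sector z x (g + of_real a * f)" if "x \<in> set pre" for x
    using assms that by (intro in_sector_add_right) (auto simp: sorted_wrt_append)
  have post: "in_sector z (g + of_real a * f) y" if "y \<in> set ys" for y
    using assms that by (intro in_sector_add_left) (auto simp: sorted_wrt_append)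
  have "in_sector z f (g + of_real a * f)" "in_sector z (g + of_real a * f) g"
    using assms by (auto simp: sorted_wrt_append
        intro!: in_sector_add_right in_sector_add_left in_sector_refl)
  with assms pre post show ?thesis
    by (auto simp: sorted_wrt_append)
qed

(* Each new entry is a nonnegative combination of two neighbours, so it can be inserted between
   them; the old entry to its right is then dropped. *)
lemma sorted_wrt_tower_step:
  fixes G :: "complex fps"
  assumes "sorted_wrt (in_sector z) (pre @ map (\<lambda>H. H $ n) (tower as G) @ [(lin_prod as * G) $ Suc n])"
    and "\<forall>a\<in>set as. a \<ge> 0" "Im z > 0"
  shows "sorted_wrt (in_sector z) (pre @ [G $ n] @ map (\<lambda>H. H $ Suc n) (tower as G))"
  using assms
proof (induction as arbitrary: pre G)
  case (Cons a as)
  define T where "T = tower as (lin_factor a * G)"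
  \<comment> \<open>With \<open>G $ n\<close> moved into the prefix, the induction first renews the
    rest of the tower, whose new head is the right neighbour needed for
    \<open>G $ Suc n\<close>.\<close>
  have "sorted_wrt (in_sector z) ((pre @ [G $ n]) @ [(lin_factor a * G) $ n] @
      map (\<lambda>H. H $ Suc n) T)"
    unfolding T_def using Cons.prems by (intro Cons.IH) (simp_all add: mult_ac)
  then have "sorted_wrt (in_sector z) (pre @ G $ n # map (\<lambda>H. H $ Suc n) T)"
    by (auto simp: sorted_wrt_append)
  moreover obtain T' where T': "T = (lin_factor a * G) # T'"
    unfolding T_def by (cases as) auto
  ultimately have "sorted_wrt (in_sector z) (pre @ G $ n #
      ((lin_factor a * G) $ Suc n + of_real a * G $ n) # map (\<lambda>H. H $ Suc n) T)"
    using Cons.prems unfolding T' list.map by (intro sorted_wrt_in_sector_insert) auto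
  then show ?case
    by (simp only: tower.simps T_def[symmetric] list.map nth_Suc_eq_lin_factor[symmetric]
        append.simps)
qed simp

text \<open>The identity c y_d = 1 + t x^r F at t = z, read off at one coefficient.\<close>

lemma lin_prod_mult_nth:
  fixes F :: "'a::real_field fps"
  assumes "(fps_const (of_real c) * lin_prod as - fps_const z * fps_X ^ r) * F = 1" "c \<noteq> 0"
  shows "(lin_prod as * F) $ n =
    of_real (inverse c) * ((if n = 0 then 1 else 0) + z * (fps_X ^ r * F) $ n)"
proof -
  define S where "S = fps_X ^ r * F"
  have "fps_const (of_real c) * (lin_prod as * F) = 1 + fps_const z * S"
    using assms(1) by (simp add: S_def algebra_simps)
  then have "of_real c * (lin_prod as * F) $ n = (1 + fps_const z * S) $ n"
    by (metis fps_mult_left_const_nth)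
  also have "\<dots> = (if n = 0 then 1 else 0) + z * S $ n"
    by simp
  finally have "of_real c * (lin_prod as * F) $ n = (if n = 0 then 1 else 0) + z * S $ n" .
  from arg_cong[OF this, of "\<lambda>w. of_real (inverse c) * w"] assms(2) show ?thesis
    by (simp add: S_def mult.assoc[symmetric])
qed

(* The first block of the list holds the coefficients F $ (n + 1 - r), ..., F $ (n - 1), those
   with a negative index being 0; the tower starts with F $ n. *)
lemma sorted_wrt_coefficients:
  fixes F :: "complex fps"
  assumes eq: "(fps_const (of_real c) * lin_prod as - fps_const z * fps_X ^ r) * F = 1"
    and "c > 0" "r > 0" "Im z > 0" "\<forall>a\<in>set as. a \<ge> 0"
  shows "sorted_wrt (in_sector z)
    (map (\<lambda>i. (fps_X ^ r * F) $ (Suc n + i)) [0..<r - 1] @ map (\<lambda>H. H $ n) (tower as F) @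
     [(lin_prod as * F) $ Suc n])"
proof -
  define S where "S = fps_X ^ r * F"
  define W where "W = (\<lambda>n. map (\<lambda>i. S $ (Suc n + i)) [0..<r - 1])"
  obtain k where k: "r = Suc k"
    using \<open>r > 0\<close> by (cases r) auto
  have S_nth: "S $ m = (if m < r then 0 else F $ (m - r))" for m
    by (simp add: S_def fps_X_power_mult_nth)
  \<comment> \<open>The entry to append is z / c times F[n + 1 - r], which is the head of the list;
    for r = 1 the block \<open>W n\<close> is empty and the head is \<open>F $ n\<close>.\<close>
  have last: "sorted_wrt (in_sector z) (W n @ map (\<lambda>H. H $ n) (tower as F) @ [(lin_prod as * F) $ Suc n])"
    if "sorted_wrt (in_sector z) (W n @ map (\<lambda>H. H $ n) (tower as F))" for n
  proof -
    have "hd (W n @ map (\<lambda>H. H $ n) (tower as F)) = S $ Suc n"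
      by (cases k) (auto simp: W_def k hd_append hd_map S_nth upt_rec[of 0])
    with sorted_wrt_in_sector_rotate[OF that, of "inverse c"] assms(2-4)
    show ?thesis
      by (simp add: lin_prod_mult_nth[OF eq] S_def)
  qed
  have "sorted_wrt (in_sector z) (W n @ map (\<lambda>H. H $ n) (tower as F))"
  proof (induction n)
    case 0
    have "W 0 = replicate k 0"
      by (auto simp: W_def k S_nth intro!: nth_equalityI)
    moreover have "map (\<lambda>H. H $ 0) (tower as F) = replicate (length (tower as F)) (F $ 0)"
      using tower_nth_0[of _ as F] by (auto simp flip: map_replicate_const)
    moreover have "sorted_wrt (in_sector z) (replicate m w)" for m w
      using \<open>Im z > 0\<close> by (induction m) (auto intro: in_sector_refl)
    ultimately show ?case
      by (auto simp: sorted_wrt_append)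
  next
    case (Suc n)
    have "sorted_wrt (in_sector z) (W n @ [F $ n] @ map (\<lambda>H. H $ Suc n) (tower as F))"
      using last[OF Suc] assms by (intro sorted_wrt_tower_step) auto
    \<comment> \<open>The window slides by one: removing its oldest entry \<open>S $ Suc n\<close>
      leaves the block for n + 1.\<close>
    moreover have "W n @ [F $ n] = S $ Suc n # W (Suc n)"
    proof -
      have "W n @ [F $ n] = map (\<lambda>i. S $ (Suc n + i)) [0..<Suc k]"
        by (simp add: W_def k S_nth)
      also have "\<dots> = S $ Suc n # W (Suc n)"
        by (subst upt_conv_Cons) (simp_all add: W_def k map_Suc_upt[symmetric] del: upt_Suc map_Suc_upt)
      finally show ?thesis .
    qed
    ultimately show ?case
      by (metis append.assoc append_Cons sorted_wrt.simps(2))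
  qed
  from last[OF this] show ?thesis
    by (simp add: W_def S_def)
qed

text \<open>H = F gives the sign condition for interlacing; H = \<open>lin_factor a * F\<close>
  serves to show that coefficients do not vanish.\<close>

lemma in_sector_successive_coefficients:
  fixes F :: "complex fps"
  assumes "(fps_const (of_real c) * lin_prod as - fps_const z * fps_X ^ r) * F = 1"
    and "c > 0" "r > 0" "Im z > 0" "\<forall>a\<in>set as. a \<ge> 0"
  shows "H \<in> set (tower as F) \<Longrightarrow> in_sector z (F $ n) (H $ Suc n)"
  using sorted_wrt_tower_step[OF sorted_wrt_coefficients[OF assms, of n] assms(5,4)]
  by (auto simp: sorted_wrt_append)

text \<open>If \<open>F $ Suc n\<close> were 0 after a nonzero \<open>F $ n\<close>, the next tower
  entry y_1 would have coefficient -a \<open>F $ n\<close>. This points opposite to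
  \<open>F $ n\<close>, outside a sector of opening arg z < pi.\<close>

lemma coefficients_nonzero:
  fixes F :: "complex fps"
  assumes eq: "(fps_const (of_real c) * lin_prod as - fps_const z * fps_X ^ r) * F = 1"
    and "c > 0" "r > 0" "Im z > 0" "\<forall>a\<in>set as. a > 0" "as \<noteq> []"
  shows "F $ n \<noteq> 0"
proof (induction n)
  case 0
  from arg_cong[OF eq, of "\<lambda>G. G $ 0"] show ?case
    by auto
next
  case (Suc n)
  obtain a as' where as: "as = a # as'"
    using \<open>as \<noteq> []\<close> by (cases as) auto
  have "a > 0"
    using assms as by simp
  show ?case
  proof
    assume "F $ Suc n = 0"
    then have H: "(lin_factor a * F) $ Suc n = - (of_real a * F $ n)"
      using nth_Suc_eq_lin_factor[of F n a] by (simp add: eq_neg_iff_add_eq_0)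
    have "lin_factor a * F \<in> set (tower as F)"
      by (cases as') (auto simp: as)
    then have "in_sector z (F $ n) ((lin_factor a * F) $ Suc n)"
      using assms by (intro in_sector_successive_coefficients[OF eq]) (auto simp: less_imp_le)
    then have "Im (z * F $ n * cnj (- (of_real a * F $ n))) \<ge> 0"
      unfolding H in_sector_def by blast
    moreover have "z * F $ n * cnj (- (of_real a * F $ n)) = of_real (- (a * (cmod (F $ n))\<^sup>2)) * z"
      by (simp add: cmod_power2_eq mult_ac)
    ultimately have "- (a * (cmod (F $ n))\<^sup>2) * Im z \<ge> 0"
      by (simp only: Im_mult_of_real)
    moreover have "a * (cmod (F $ n))\<^sup>2 * Im z > 0"
      using \<open>a > 0\<close> \<open>Im z > 0\<close> Suc by simp
    ultimately show False
      by simp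
  qed
qed

section \<open>Positivity on the nonnegative axis\<close>

text \<open>Dividing by 1 - a x means multiplying by a geometric series with nonnegative
  coefficients. The bound n makes the lemma usable inside a strong induction.\<close>

lemma nonneg_coefficients_div_lin_prod:
  fixes G :: "real fps"
  assumes "\<And>m. m \<le> n \<Longrightarrow> (lin_prod as * G) $ m \<ge> 0" "\<forall>a\<in>set as. a \<ge> 0"
  shows "m \<le> n \<Longrightarrow> G $ m \<ge> 0"
  using assms
proof (induction as arbitrary: G m)
  case (Cons a as)
  have H: "(lin_factor a * G) $ m \<ge> 0" if "m \<le> n" for m
    by (rule Cons.IH[OF that]) (use Cons.prems in \<open>simp_all add: mult_ac\<close>)
  show ?case
    using \<open>m \<le> n\<close>
  proof (induction m)
    case 0
    then show ?case using H[of 0] by simp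
  next
    case (Suc m)
    then show ?case
      using H[of "Suc m"] Cons.prems by (subst nth_Suc_eq_lin_factor[of G m a]) auto
  qed
qed simp

text \<open>For x >= 0 the recursions involve no cancellation, and strictness spreads from
  \<open>F $ 0\<close> because \<open>F $ Suc n\<close> is at least a \<open>F $ n\<close>. This
  excludes nonnegative zeros and fixes the sign of the leading coefficient.\<close>

lemma coefficients_pos:
  fixes F :: "real fps"
  assumes eq: "(fps_const (of_real c) * lin_prod as - fps_const x * fps_X ^ r) * F = 1"
    and "c > 0" "r > 0" "x \<ge> 0" "\<forall>a\<in>set as. a > 0" "as \<noteq> []"
  shows "F $ n > 0"
proof -
  have nonneg: "F $ m \<ge> 0 \<and> (lin_prod as * F) $ m \<ge> 0" for m
  proof (induction m rule: less_induct)
    case (less m)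
    \<comment> \<open>Apart from the constant 1 at index 0, only \<open>F $ (m' - r)\<close> enters,
      an earlier coefficient since r > 0, or 0 if m' < r.\<close>
    have "(lin_prod as * F) $ m' \<ge> 0" if "m' \<le> m" for m'
      unfolding lin_prod_mult_nth[OF eq less_imp_neq[OF \<open>c > 0\<close>, symmetric]]
      using that assms less[of "m' - r"] by (auto simp: fps_X_power_mult_nth)
    then show ?case
      using nonneg_coefficients_div_lin_prod[of m as F m] assms(5) by (auto simp: less_imp_le)
  qed
  obtain a as' where as: "as = a # as'"
    using \<open>as \<noteq> []\<close> by (cases as) auto
  show ?thesis
  proof (induction n)
    case 0
    from arg_cong[OF eq, of "\<lambda>G. G $ 0"] have "F $ 0 \<noteq> 0"
      by auto
    with nonneg[of 0] show ?case by auto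
  next
    case (Suc n)
    have "(lin_factor a * F) $ Suc n \<ge> 0"
      by (rule nonneg_coefficients_div_lin_prod[of "Suc n" as'])
        (use nonneg assms(5) in \<open>auto simp: as mult_ac intro: less_imp_le\<close>)
    with Suc assms(5) as show ?case
      by (subst nth_Suc_eq_lin_factor[of F n a]) (auto intro: add_nonneg_pos)
  qed
qed

section \<open>Specialising the indeterminate t to a number\<close>

definition eval_coeffs :: "'a::real_field \<Rightarrow> real poly fps \<Rightarrow> 'a fps" where
  "eval_coeffs z F = Abs_fps (\<lambda>n. real_poly_eval z (F $ n))"

lemma eval_coeffs_nth [simp]: "eval_coeffs z F $ n = real_poly_eval z (F $ n)"
  by (simp add: eval_coeffs_def)

lemma eval_coeffs_mult: "eval_coeffs z (F * G) = eval_coeffs z F * eval_coeffs z G"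
  by (rule fps_ext) (simp add: fps_mult_nth real_poly_eval_sum real_poly_eval_mult)

lemma eval_coeffs_1 [simp]: "eval_coeffs z 1 = 1"
  by (rule fps_ext) simp

lemma eval_coeffs_denominator_series:
  fixes z :: "'a::real_field"
  assumes "Q = smult c (\<Prod>a\<leftarrow>as. [:1, -a:])"
  shows "eval_coeffs z (denominator_series Q r) =
    fps_const (of_real c) * lin_prod as - fps_const z * fps_X ^ r"
proof -
  have "eval_coeffs z (denominator_series Q r) =
      fps_of_poly (map_poly of_real Q) - fps_const z * fps_X ^ r"
    by (intro fps_ext) (simp add: denominator_series_def coeff_map_poly
        real_poly_eval_diff real_poly_eval_minus)
  moreover have linear: "fps_of_poly (map_poly of_real [:1, -a:]) = (lin_factor a :: 'a fps)" for a
    by (simp add: map_poly_pCons fps_of_poly_linear' lin_factor_def flip: fps_const_neg)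
  have "fps_of_poly (map_poly of_real (\<Prod>a\<leftarrow>as. [:1, -a:])) = (lin_prod as :: 'a fps)"
    by (induction as)
      (simp_all only: list.map prod_list.Cons prod_list.Nil map_poly_of_real_mult fps_of_poly_mult
        lin_prod_simps linear, simp)
  then have "fps_of_poly (map_poly of_real Q) = (fps_const (of_real c) * lin_prod as :: 'a fps)"
    by (simp add: assms map_poly_smult fps_of_poly_smult)
  ultimately show ?thesis
    by simp
qed

text \<open>For constant Q the recursion c q_n = [n = 0] + t q_(n-r) yields only 0 or positive
  multiples of powers of t, so a nonzero q_n can vanish only at 0.\<close>

lemma coefficients_constant_denominator:
  fixes F :: "real poly fps"
  assumes eq: "denominator_series [:c:] r * F = 1" and "c > 0" "r > 0"
  shows "real_rooted (F $ n) \<and> (F $ n \<noteq> 0 \<longrightarrow> lead_coeff (F $ n) > 0)"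
proof -
  have "(\<forall>z::complex. z \<noteq> 0 \<longrightarrow> F $ n \<noteq> 0 \<longrightarrow> real_poly_eval z (F $ n) \<noteq> 0) \<and>
      (F $ n \<noteq> 0 \<longrightarrow> lead_coeff (F $ n) > 0)"
  proof (induction n rule: less_induct)
    case (less n)
    have "fps_const [:c:] * F = 1 + fps_const [:0, 1:] * (fps_X ^ r * F)"
      using eq by (simp add: denominator_series_def map_poly_pCons fps_of_poly_const algebra_simps)
    then have "[:c:] * F $ n = (1 + fps_const [:0, 1:] * (fps_X ^ r * F)) $ n"
      by (metis fps_mult_left_const_nth)
    then have *: "smult c (F $ n) = (if n = 0 then 1 else 0) + (if n < r then 0 else pCons 0 (F $ (n - r)))"
      by (simp add: fps_X_power_mult_nth)
    have "F $ n = smult (inverse c) (smult c (F $ n))"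
      using \<open>c > 0\<close> by simp
    also note *
    finally have "F $ n = smult (inverse c)
        ((if n = 0 then 1 else 0) + (if n < r then 0 else pCons 0 (F $ (n - r))))" .
    with less[of "n - r"] \<open>c > 0\<close> \<open>r > 0\<close> show ?case
      by (auto simp: real_poly_eval_smult lead_coeff_pCons)
  qed
  then show ?thesis
    unfolding real_rooted_def real_poly_eval_def[symmetric] by (metis Reals_0)
qed

theorem theorem4p5:
  fixes Q :: "real poly" and r :: nat
  assumes "poly Q 0 > 0"
    and "\<And>z::complex. poly (map_poly complex_of_real Q) z = 0 \<Longrightarrow> z \<in> \<real> \<and> Re z > 0"
    and "r > 0"
  shows "\<exists>q :: nat \<Rightarrow> real poly.
           denominator_series Q r * Abs_fps q = 1 \<and>
           (degree Q > 0 \<longrightarrow>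
              (\<forall>n. \<forall>z::complex. poly (map_poly complex_of_real (q n)) z = 0 \<longrightarrow>
                 z \<in> \<real> \<and> Re z < 0)) \<and>
           (\<forall>n. q n \<prec>\<^sub>I q (Suc n))"
proof -
  define c where "c = poly Q 0"
  have "c > 0"
    using assms(1) by (simp add: c_def)
  obtain as where Q: "Q = smult c (\<Prod>a\<leftarrow>as. [:1, -a:])" and as: "\<forall>a\<in>set as. a > 0"
    using positive_rooted_factorization[of Q] assms(1,2) unfolding c_def real_poly_eval_def
    by (metis less_irrefl)
  define D where "D = denominator_series Q r"
  \<comment> \<open>As r > 0, the term t x^r does not reach the constant coefficient, which is
    therefore a unit of R[t].\<close>
  have "D $ 0 = [:c:]"
    using \<open>r > 0\<close> by (simp add: D_def denominator_series_def coeff_map_poly c_def poly_0_coeff_0)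
  then have "D $ 0 * [:inverse c:] = 1"
    using \<open>c > 0\<close> by (simp add: one_pCons)
  then obtain F where F: "D * F = 1"
    using fps_right_inverse by blast
  \<comment> \<open>Kept polymorphic: used over the complex numbers for the sector argument and over
    the reals for positivity.\<close>
  have eval: "(fps_const (of_real c) * lin_prod as - fps_const z * fps_X ^ r) * eval_coeffs z F = 1"
    for z :: "'b::real_field"
    using arg_cong[OF F, of "eval_coeffs z"]
    by (simp add: eval_coeffs_mult D_def eval_coeffs_denominator_series[OF Q])
  have sector: "Im (real_poly_eval z (F $ Suc n) * cnj (real_poly_eval z (F $ n))) \<ge> 0"
    if "Im z > 0" for z n
    using in_sector_successive_coefficients[OF eval \<open>c > 0\<close> \<open>r > 0\<close> that, of "eval_coeffs z F" n]
      as hd_in_set[OF tower_neq_Nil, of as "eval_coeffs z F"]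
    by (auto simp: in_sector_def less_imp_le)
  have roots: "z \<in> \<real> \<and> Re z < 0" if "as \<noteq> []" "real_poly_eval z (F $ n) = 0" for z :: complex and n
  proof -
    have nz: "real_poly_eval w (F $ n) \<noteq> 0" if "Im w > 0" for w
      using coefficients_nonzero[OF eval \<open>c > 0\<close> \<open>r > 0\<close> that as \<open>as \<noteq> []\<close>, of n] by simp
    \<comment> \<open>Zeros of a real polynomial come in conjugate pairs, so excluding the upper
      half plane excludes the lower one too.\<close>
    have "\<not> Im z > 0" "\<not> Im (cnj z) > 0"
      using nz[of z] nz[of "cnj z"] that(2) by (auto simp: real_poly_eval_cnj)
    then have z: "z = of_real (Re z)"
      by (simp add: complex_eq_iff)
    then have "poly (F $ n) (Re z) = 0"
      using that(2) by (metis of_real_eq_0_iff real_poly_eval_of_real)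
    then have "\<not> Re z \<ge> 0"
      using coefficients_pos[OF eval \<open>c > 0\<close> \<open>r > 0\<close> _ as \<open>as \<noteq> []\<close>, of "Re z" n]
      by (auto simp: real_poly_eval_real)
    with z show ?thesis
      by (metis Reals_of_real not_le)
  qed
  \<comment> \<open>Interlacing is claimed for constant Q as well, where a zero at 0 can occur, so
    real-rootedness is established separately from the negativity of the zeros.\<close>
  have rr: "real_rooted (F $ n) \<and> (F $ n \<noteq> 0 \<longrightarrow> lead_coeff (F $ n) > 0)" for n
  proof (cases "as = []")
    case True
    with Q F \<open>c > 0\<close> \<open>r > 0\<close> show ?thesis
      by (intro coefficients_constant_denominator[of c r]) (simp_all add: D_def)
  next
    case False
    have "poly (F $ n) x > 0" if "x > 0" for x
      using coefficients_pos[OF eval \<open>c > 0\<close> \<open>r > 0\<close> less_imp_le[OF that] as False, of n]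
      by (simp add: real_poly_eval_real)
    then have "lead_coeff (F $ n) > 0"
      by (rule lead_coeff_pos_if_pos_on_pos)
    with roots[OF False] show ?thesis
      by (auto simp: real_rooted_def real_poly_eval_def)
  qed
  have "F $ n \<prec>\<^sub>I F $ Suc n" for n
    using rr sector by (intro interlacesI) auto
  moreover have "as \<noteq> []" if "degree Q > 0"
  proof
    assume "as = []"
    then have "Q = [:c:]"
      by (subst Q) simp
    with that show False by simp
  qed
  ultimately show ?thesis
    using F roots unfolding D_def real_poly_eval_def
    by (intro exI[of _ "fps_nth F"]) (simp add: fps_nth_inverse)
qed

end
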